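(* Let $I\subset\mathbb{R}$ be an interval, let $p\in\mathbb{R}\setminus\{0\}$, let $\alpha\in(0,1)$, and let $u:I\to\mathbb{R}$ be a hyperbolic $p$-convex function on $I$. Then for any $a,b\in I$ with $a<b$, $$u\left(\frac{a+b}{2}\right)\mathcal{C}^2_{\alpha}(1)\;\leq\;\mathcal{I}^{\alpha}_{a+}u(b)+\mathcal{I}^{\alpha}_{b-}u(a)\;\leq\;\frac{u(a)+u(b)}{2}\cdot\frac{1}{\cosh\left(\frac{p(b-a)}{2}\right)}\,\mathcal{C}^2_\alpha(1),$$ where $$\mathcal{C}^2_{\alpha}(1):=\int_a^b\cosh\left[p\left(x-\frac{a+b}{2}\right)\right]\frac{\exp\left(-\frac{1-\alpha}{\alpha}(b-x)\right)+\exp\left(-\frac{1-\alpha}{\alpha}(x-a)\right)}{\alpha}\,dx.$$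
   Context: A function $f:I\to\mathbb{R}$ is hyperbolic $p$-convex on $I$ if for every closed subinterval $[a,b]\subset I$ (with $a<b$) and all $x\in[a,b]$, $$f(x)\leq \frac{\sinh[p(b-x)]}{\sinh[p(b-a)]}f(a)+\frac{\sinh[p(x-a)]}{\sinh[p(b-a)]}f(b).$$ For $\alpha\in(0,1)$ and $f\in L_1(a,b)$, the fractional integrals with exponential kernel are $\mathcal{I}^\alpha_{a+}f(x)=\frac1\alpha\int_a^x\exp\left(-\frac{1-\alpha}{\alpha}(x-s)\right)f(s)\,ds$ for $x>a$ and $\mathcal{I}^\alpha_{b-}f(x)=\frac1\alpha\int_x^b\exp\left(-\frac{1-\alpha}{\alpha}(s-x)\right)f(s)\,ds$ for $x<b$. *)

theory Defs
  imports "HOL-Analysis.Analysis"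
begin

definition hyperbolic_p_convex_on :: "real \<Rightarrow> real set \<Rightarrow> (real \<Rightarrow> real) \<Rightarrow> bool" where
  "hyperbolic_p_convex_on p I f \<longleftrightarrow>
     (\<forall>a b. a < b \<and> {a..b} \<subseteq> I \<longrightarrow>
       (\<forall>x\<in>{a..b}.
          f x \<le> sinh (p * (b - x)) / sinh (p * (b - a)) * f a
               + sinh (p * (x - a)) / sinh (p * (b - a)) * f b))"

text \<open>
  The operators are meant for \<open>f\<close> Lebesgue integrable on the interval in question. The integrals
  are taken with respect to the completed measure \<open>lebesgue\<close>, so that they have the intended
  value for every such \<open>f\<close>, Borel measurable or not. For the left operator \<open>x > a\<close> is intended,
  for the right one \<open>x < b\<close>.
\<close>

definition frac_int_left :: "real \<Rightarrow> real \<Rightarrow> (real \<Rightarrow> real) \<Rightarrow> real \<Rightarrow> real" where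
  "frac_int_left \<alpha> a f x =
     1 / \<alpha> * (LINT s:{a..x}|lebesgue. exp (- ((1 - \<alpha>) / \<alpha>) * (x - s)) * f s)"

definition frac_int_right :: "real \<Rightarrow> real \<Rightarrow> (real \<Rightarrow> real) \<Rightarrow> real \<Rightarrow> real" where
  "frac_int_right \<alpha> b f x =
     1 / \<alpha> * (LINT s:{x..b}|lebesgue. exp (- ((1 - \<alpha>) / \<alpha>) * (s - x)) * f s)"

text \<open>The constant \<open>C\<^sup>2\<^sub>\<alpha>(1)\<close>, with its dependence on \<open>p\<close>, \<open>a\<close>, \<open>b\<close> made explicit.\<close>

definition C2_one :: "real \<Rightarrow> real \<Rightarrow> real \<Rightarrow> real \<Rightarrow> real" where
  "C2_one p \<alpha> a b =
     (LINT x:{a..b}|lebesgue.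
        cosh (p * (x - (a + b) / 2)) *
        ((exp (- ((1 - \<alpha>) / \<alpha>) * (b - x)) + exp (- ((1 - \<alpha>) / \<alpha>) * (x - a))) / \<alpha>))"

end

theory Submission
  imports Defs
begin

text \<open>
  Write \<open>m = (a + b) / 2\<close> and \<open>w x = (exp (- k * (b - x)) + exp (- k * (x - a))) / \<alpha>\<close> with
  \<open>k = (1 - \<alpha>) / \<alpha>\<close>. The sum of the two fractional integrals is the integral of
  \<open>w * u\<close> over \<open>[a, b]\<close>, and \<open>w\<close> is invariant under the reflection \<open>x \<mapsto> a + b - x\<close>.
  An integral over \<open>[a, b]\<close> sees only the sum of the values of the integrand at \<open>x\<close> and at
  \<open>a + b - x\<close> (lemma \<open>integral_le_by_reflection\<close>), so that both inequalities follow from the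
  pointwise estimates

    \<open>2 * cosh (p * (x - m)) * u m \<le> u x + u (a + b - x)
       \<le> cosh (p * (x - m)) / cosh (p * (b - a) / 2) * (u a + u b)\<close>.

  The left one is hyperbolic convexity on the interval between \<open>x\<close> and \<open>a + b - x\<close>, taken at
  its midpoint \<open>m\<close>; the right one adds the convexity inequalities on \<open>[a, b]\<close> at \<open>x\<close> and at
  \<open>a + b - x\<close>.

  Comparing the integrals presupposes that \<open>u\<close> is integrable on \<open>[a, b]\<close>. Hyperbolic convexity of
  \<open>u\<close> is ordinary convexity of \<open>exp (p * x) * u x\<close> as a function of \<open>exp (2 * p * x)\<close>, so \<open>u\<close> is
  continuous on the open interval. It is bounded: from above by the values at the end points, and
  then from below by the left pointwise estimate.
\<close>

section \<open>Integrals and reflection\<close>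

lemma has_integral_reflect_interval:
  fixes f :: "real \<Rightarrow> real"
  assumes "(f has_integral i) {a..b}"
  shows "((\<lambda>x. f (a + b - x)) has_integral i) {a..b}"
proof -
  have "((\<lambda>x. f ((-1) *\<^sub>R x + (a + b))) has_integral (1 / (\<bar>-1\<bar> ^ DIM(real))) *\<^sub>R i)
      ((\<lambda>x. (1 / (-1)) *\<^sub>R x + - ((1 / (-1)) *\<^sub>R (a + b))) ` cbox a b)"
    by (rule has_integral_affinity) (use assms in \<open>auto simp: cbox_interval\<close>)
  moreover have "(\<lambda>x. (1 / (-1)) *\<^sub>R x + - ((1 / (-1)) *\<^sub>R (a + b))) ` cbox a b = {a..b}"
    by (simp add: cbox_interval add.commute[of "- _"] flip: diff_conv_add_uminus)
  ultimately show ?thesis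
    by (simp add: algebra_simps)
qed

text \<open>
  The integral of \<open>f\<close> is half the integral of \<open>f x + f (a + b - x)\<close>. Hence pointwise comparison of
  the symmetrised integrands is enough, even where \<open>f\<close> and \<open>g\<close> themselves are not comparable.
\<close>
lemma integral_le_by_reflection:
  fixes f g :: "real \<Rightarrow> real"
  assumes f: "f integrable_on {a..b}" and g: "g integrable_on {a..b}"
    and le: "\<And>x. x \<in> {a..b} \<Longrightarrow> f x + f (a + b - x) \<le> g x + g (a + b - x)"
  shows "integral {a..b} f \<le> integral {a..b} g"
proof -
  have sym: "((\<lambda>x. h x + h (a + b - x)) has_integral integral {a..b} h + integral {a..b} h) {a..b}"
    if "h integrable_on {a..b}" for h :: "real \<Rightarrow> real"
    using that by (intro has_integral_add has_integral_reflect_interval integrable_integral)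
  have "integral {a..b} f + integral {a..b} f \<le> integral {a..b} g + integral {a..b} g"
    using has_integral_le[OF sym[OF f] sym[OF g] le] by simp
  then show ?thesis by simp
qed

lemma bounded_continuous_open_imp_absolutely_integrable:
  fixes f :: "real \<Rightarrow> real"
  assumes cont: "continuous_on {a<..<b} f"
    and bound: "\<And>x. x \<in> {a<..<b} \<Longrightarrow> \<bar>f x\<bar> \<le> B"
  shows "f absolutely_integrable_on {a..b}"
proof -
  have "f absolutely_integrable_on {a<..<b}"
  proof (rule measurable_bounded_by_integrable_imp_absolutely_integrable)
    show "f \<in> borel_measurable (lebesgue_on {a<..<b})"
      by (rule continuous_imp_measurable_on_sets_lebesgue[OF cont]) simp
    show "(\<lambda>x. B) integrable_on {a<..<b}"
      by (simp add: integrable_on_open_interval_real integrable_const_ivl)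
  qed (use bound in auto)
  then show ?thesis
    using absolutely_integrable_on_open_interval[where f = f and a = a and b = b] by simp
qed

section \<open>Hyperbolic convex functions\<close>

lemma hyperbolic_p_convex_on_uminus:
  "hyperbolic_p_convex_on (- p) I f \<longleftrightarrow> hyperbolic_p_convex_on p I f"
  by (simp add: hyperbolic_p_convex_on_def)

text \<open>
  The coefficients are quotients of values of an odd function; so \<open>p\<close> may be taken positive, and
  \<open>exp (2 * p * x)\<close> increasing in \<open>x\<close>, when ordinary convexity is extracted.
\<close>
lemma hyperbolic_p_convex_on_abs:
  "hyperbolic_p_convex_on \<bar>p\<bar> I f \<longleftrightarrow> hyperbolic_p_convex_on p I f"
  by (simp add: abs_if hyperbolic_p_convex_on_uminus)

lemma hyperbolic_p_convex_on_subset: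
  "hyperbolic_p_convex_on p I f \<Longrightarrow> J \<subseteq> I \<Longrightarrow> hyperbolic_p_convex_on p J f"
  unfolding hyperbolic_p_convex_on_def by (meson order_trans)

lemma hyperbolic_p_convex_onD:
  assumes "hyperbolic_p_convex_on p I f" "a < b" "{a..b} \<subseteq> I" "x \<in> {a..b}"
  shows "f x \<le> sinh (p * (b - x)) / sinh (p * (b - a)) * f a
             + sinh (p * (x - a)) / sinh (p * (b - a)) * f b"
  using assms unfolding hyperbolic_p_convex_on_def by blast

text \<open>
  At the midpoint both coefficients of the convexity inequality equal \<open>1 / (2 * cosh (p * h))\<close>,
  where \<open>h\<close> is half the length of the interval between \<open>x\<close> and \<open>a + b - x\<close>, because \<open>sinh (2 * p * h)\<close> is
  \<open>2 * sinh (p * h) * cosh (p * h)\<close>.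
\<close>
lemma hyperbolic_p_convex_on_midpoint:
  assumes f: "hyperbolic_p_convex_on p {a..b} f" and "p \<noteq> 0" and x: "x \<in> {a..b}"
  shows "2 * cosh (p * (x - (a + b) / 2)) * f ((a + b) / 2) \<le> f x + f (a + b - x)"
proof -
  have sym: "2 * cosh (p * h) * f ((a + b) / 2) \<le> f ((a + b) / 2 - h) + f ((a + b) / 2 + h)"
    if h: "0 \<le> h" "h \<le> (b - a) / 2" for h
  proof (cases "h = 0")
    case False
    define m where "m = (a + b) / 2"
    have "f m \<le> sinh (p * (m + h - m)) / sinh (p * (m + h - (m - h))) * f (m - h)
             + sinh (p * (m - (m - h))) / sinh (p * (m + h - (m - h))) * f (m + h)"
      using h False by (intro hyperbolic_p_convex_onD[OF f]) (auto simp: m_def field_simps)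
    also have "m + h - m = h" by simp
    also have "m - (m - h) = h" by simp
    also have "p * (m + h - (m - h)) = 2 * (p * h)" by (simp add: algebra_simps)
    also have "sinh (p * h) / sinh (2 * (p * h)) = 1 / (2 * cosh (p * h))"
      using False \<open>p \<noteq> 0\<close> by (simp add: sinh_double)
    also have "1 / (2 * cosh (p * h)) * f (m - h) + 1 / (2 * cosh (p * h)) * f (m + h)
        = (f (m - h) + f (m + h)) / (2 * cosh (p * h))"
      by (simp add: add_divide_distrib)
    finally show ?thesis
      by (simp add: pos_le_divide_eq mult.commute m_def)
  qed simp
  define h where "h = \<bar>x - (a + b) / 2\<bar>"
  have "0 \<le> h" "h \<le> (b - a) / 2"
    using x by (auto simp: h_def abs_if field_simps)
  then have "2 * cosh (p * h) * f ((a + b) / 2) \<le> f ((a + b) / 2 - h) + f ((a + b) / 2 + h)"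
    by (rule sym)
  moreover have "cosh (p * h) = cosh (p * (x - (a + b) / 2))"
    by (simp add: h_def abs_mult)
  moreover have "(a + b) / 2 - h = x \<and> (a + b) / 2 + h = a + b - x
      \<or> (a + b) / 2 - h = a + b - x \<and> (a + b) / 2 + h = x"
    unfolding h_def by argo
  ultimately show ?thesis
    by (elim disjE conjE) (simp_all only: add.commute[of "f (a + b - x)"])
qed

text \<open>
  Adding the convexity inequalities at the two points gives both end points the same coefficient
  \<open>(sinh (p * (b - x)) + sinh (p * (x - a))) / sinh (p * (b - a))\<close>; the sum-to-product formula
  turns it into a quotient of hyperbolic cosines.
\<close>
lemma hyperbolic_p_convex_on_endpoints:
  assumes f: "hyperbolic_p_convex_on p {a..b} f" and "p \<noteq> 0" and "a < b" and x: "x \<in> {a..b}"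
  shows "f x + f (a + b - x)
      \<le> cosh (p * (x - (a + b) / 2)) / cosh (p * (b - a) / 2) * (f a + f b)"
proof -
  define h where "h = p * (b - a) / 2"
  define d where "d = p * (x - (a + b) / 2)"
  define S where "S = sinh (2 * h)"
  have args: "p * (b - a) = 2 * h" "p * (b - x) = h - d" "p * (x - a) = h + d"
    "p * (b - (a + b - x)) = h + d" "p * (a + b - x - a) = h - d"
    by (simp_all add: h_def d_def field_simps)
  have "h \<noteq> 0"
    using \<open>p \<noteq> 0\<close> \<open>a < b\<close> by (simp add: h_def)
  have "f x \<le> sinh (h - d) / S * f a + sinh (h + d) / S * f b"
    using hyperbolic_p_convex_onD[OF f \<open>a < b\<close> order.refl x] by (simp add: args S_def)
  moreover have "f (a + b - x) \<le> sinh (h + d) / S * f a + sinh (h - d) / S * f b"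
    using hyperbolic_p_convex_onD[OF f \<open>a < b\<close> order.refl, of "a + b - x"] x
    by (simp only: args S_def) simp
  ultimately have "f x + f (a + b - x)
      \<le> (sinh (h - d) / S + sinh (h + d) / S) * (f a + f b)"
    unfolding ring_distribs by linarith
  also have "sinh (h - d) / S + sinh (h + d) / S = cosh d / cosh h"
    using \<open>h \<noteq> 0\<close> unfolding S_def sinh_double by (simp add: sinh_add sinh_diff field_simps)
  finally show ?thesis
    by (simp add: h_def d_def)
qed

text \<open>
  Since \<open>sinh (p * (y - x)) = (exp (2 * p * y) - exp (2 * p * x)) / (2 * exp (p * x) * exp (p * y))\<close>,
  the coefficients become affine in \<open>exp (2 * p * x)\<close> once \<open>f x\<close> is multiplied by \<open>exp (p * x)\<close>.
  Below, \<open>s\<close> stands for \<open>exp (2 * p * x)\<close> and the factor \<open>sqrt s\<close> for \<open>exp (p * x)\<close>.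
\<close>
lemma hyperbolic_p_convex_on_imp_convex_on:
  assumes f: "hyperbolic_p_convex_on p {a..b} f" and "p > 0"
  shows "convex_on {exp (2 * p * a)<..<exp (2 * p * b)} (\<lambda>s. sqrt s * f (ln s / (2 * p)))"
proof (rule convex_on_linorderI)
  fix t y z :: real
  assume t: "0 < t" "t < 1" and "y < z"
    and y: "y \<in> {exp (2 * p * a)<..<exp (2 * p * b)}"
    and z: "z \<in> {exp (2 * p * a)<..<exp (2 * p * b)}"
  define Y Z where "Y = ln y / (2 * p)" and "Z = ln z / (2 * p)"
  define s where "s = (1 - t) * y + t * z"
  define X where "X = ln s / (2 * p)"
  have pos: "0 < y" "0 < z"
    using y z exp_gt_zero[of "2 * p * a"] by (auto intro: less_trans[OF exp_gt_zero])
  have s_diff: "s - y = t * (z - y)" "z - s = (1 - t) * (z - y)"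
    by (simp_all add: s_def algebra_simps)
  then have s: "y < s" "s < z"
    using t \<open>y < z\<close> by (smt (verit) mult_pos_pos)+
  with pos have "0 < s" by simp
  have "Y < X" "X < Z" "Y < Z"
    using s pos \<open>0 < s\<close> \<open>p > 0\<close> by (auto simp: X_def Y_def Z_def divide_strict_right_mono)
  have "2 * p * a < ln y"
    using y pos ln_less_cancel_iff[of "exp (2 * p * a)" y] by simp
  moreover have "ln z < 2 * p * b"
    using z pos ln_less_cancel_iff[of z "exp (2 * p * b)"] by simp
  ultimately have "a \<le> Y" "Z \<le> b"
    using \<open>p > 0\<close> by (simp_all add: Y_def Z_def field_simps)
  have "(exp (p * Y))\<^sup>2 = y" "(exp (p * X))\<^sup>2 = s" "(exp (p * Z))\<^sup>2 = z"
    using pos \<open>0 < s\<close> \<open>p > 0\<close> by (simp_all add: X_def Y_def Z_def flip: exp_double)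
  then have e: "exp (p * Y) = sqrt y" "exp (p * X) = sqrt s" "exp (p * Z) = sqrt z"
    by (simp_all add: real_sqrt_unique)
  have sinh_e: "sinh (p * (v - u)) = (d\<^sup>2 - c\<^sup>2) / (2 * c * d)"
    if "exp (p * u) = c" "exp (p * v) = d" for u v c d
    using that[symmetric]
    by (simp add: sinh_field_def exp_diff right_diff_distrib field_simps power2_eq_square
        flip: exp_minus)
  have "f X \<le> sinh (p * (Z - X)) / sinh (p * (Z - Y)) * f Y
             + sinh (p * (X - Y)) / sinh (p * (Z - Y)) * f Z"
    using \<open>Y < X\<close> \<open>X < Z\<close> \<open>Y < Z\<close> \<open>a \<le> Y\<close> \<open>Z \<le> b\<close> by (intro hyperbolic_p_convex_onD[OF f]) auto
  also have "sinh (p * (Z - X)) / sinh (p * (Z - Y)) = (1 - t) * sqrt y / sqrt s"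
    using pos \<open>0 < s\<close> \<open>y < z\<close>
    unfolding sinh_e[OF e(2,3)] sinh_e[OF e(1,3)] by (simp add: s_diff)
  also have "sinh (p * (X - Y)) / sinh (p * (Z - Y)) = t * sqrt z / sqrt s"
    using pos \<open>0 < s\<close> \<open>y < z\<close>
    unfolding sinh_e[OF e(1,2)] sinh_e[OF e(1,3)] by (simp add: s_diff)
  also have "(1 - t) * sqrt y / sqrt s * f Y + t * sqrt z / sqrt s * f Z
      = ((1 - t) * (sqrt y * f Y) + t * (sqrt z * f Z)) / sqrt s"
    by (simp add: add_divide_distrib)
  finally have "sqrt s * f X \<le> (1 - t) * (sqrt y * f Y) + t * (sqrt z * f Z)"
    using \<open>0 < s\<close> by (simp add: pos_le_divide_eq mult.commute)
  then show "sqrt ((1 - t) *\<^sub>R y + t *\<^sub>R z) * f (ln ((1 - t) *\<^sub>R y + t *\<^sub>R z) / (2 * p))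
      \<le> (1 - t) * (sqrt y * f (ln y / (2 * p))) + t * (sqrt z * f (ln z / (2 * p)))"
    by (simp add: s_def X_def Y_def Z_def)
qed simp

lemma hyperbolic_p_convex_on_imp_continuous_on:
  assumes "hyperbolic_p_convex_on p {a..b} f" and "p \<noteq> 0"
  shows "continuous_on {a<..<b} f"
proof -
  define q where "q = \<bar>p\<bar>"
  define g where "g = (\<lambda>s. sqrt s * f (ln s / (2 * q)))"
  have "q > 0" using \<open>p \<noteq> 0\<close> by (simp add: q_def)
  have "convex_on {exp (2 * q * a)<..<exp (2 * q * b)} g"
    unfolding g_def using assms \<open>q > 0\<close>
    by (intro hyperbolic_p_convex_on_imp_convex_on) (simp_all add: q_def hyperbolic_p_convex_on_abs)
  then have g: "continuous_on {exp (2 * q * a)<..<exp (2 * q * b)} g"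
    by (intro convex_on_continuous) auto
  have "continuous_on {a<..<b} (\<lambda>x. exp (- q * x) * g (exp (2 * q * x)))"
    using \<open>q > 0\<close>
    by (intro continuous_intros continuous_on_compose2[OF g]) auto
  moreover have "exp (- q * x) * g (exp (2 * q * x)) = f x" for x
  proof -
    have "sqrt (exp (2 * q * x)) = exp (q * x)"
      by (rule real_sqrt_unique) (simp_all add: mult.assoc flip: exp_double)
    then show ?thesis
      using \<open>q > 0\<close> by (simp add: g_def exp_minus)
  qed
  ultimately show ?thesis by simp
qed

lemma sinh_ratio_bounds:
  fixes p y z :: real
  assumes "p \<noteq> 0" "0 \<le> y" "y \<le> z" "0 < z"
  shows "\<bar>sinh (p * y) / sinh (p * z)\<bar> \<le> 1"
proof -
  have "\<bar>sinh (p * y)\<bar> = sinh (\<bar>p\<bar> * y)" "\<bar>sinh (p * z)\<bar> = sinh (\<bar>p\<bar> * z)"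
    using assms by (simp_all add: abs_mult flip: sinh_real_abs)
  moreover have "0 < sinh (\<bar>p\<bar> * z)" "sinh (\<bar>p\<bar> * y) \<le> sinh (\<bar>p\<bar> * z)"
    using assms by (simp_all add: mult_left_mono)
  ultimately show ?thesis
    by simp
qed

text \<open>
  The coefficients in the convexity inequality are at most \<open>1\<close> in absolute value, which bounds \<open>f\<close>
  from above. The midpoint inequality bounds \<open>f x\<close> from below by a bounded term minus
  \<open>f (a + b - x)\<close>, so the upper bound at the reflected point gives the lower bound at \<open>x\<close>.
\<close>
lemma hyperbolic_p_convex_on_imp_bounded:
  assumes f: "hyperbolic_p_convex_on p {a..b} f" and "p \<noteq> 0" and "a < b"
  obtains B where "\<And>x. x \<in> {a..b} \<Longrightarrow> \<bar>f x\<bar> \<le> B"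
proof -
  define M where "M = \<bar>f a\<bar> + \<bar>f b\<bar>"
  define K where "K = cosh (p * (b - a)) * \<bar>f ((a + b) / 2)\<bar>"
  have upper: "f x \<le> M" if x: "x \<in> {a..b}" for x
  proof -
    have part: "c * v \<le> \<bar>v\<bar>" if "\<bar>c\<bar> \<le> 1" for c v :: real
      using mult_right_mono[OF that abs_ge_zero[of v]] by (simp add: abs_le_iff flip: abs_mult)
    show ?thesis
      using hyperbolic_p_convex_onD[OF f \<open>a < b\<close> order.refl x]
        part[OF sinh_ratio_bounds[of p "b - x" "b - a"], of "f a"]
        part[OF sinh_ratio_bounds[of p "x - a" "b - a"], of "f b"] x assms
      by (simp add: M_def)
  qed
  have lower: "- (M + 2 * K) \<le> f x" if x: "x \<in> {a..b}" for x
  proof -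
    have "\<bar>x - (a + b) / 2\<bar> \<le> \<bar>b - a\<bar>"
      using x by (auto simp: abs_if field_simps)
    then have "\<bar>p * (x - (a + b) / 2)\<bar> \<le> \<bar>p * (b - a)\<bar>"
      unfolding abs_mult by (rule mult_left_mono) simp
    then have "cosh (p * (x - (a + b) / 2)) \<le> cosh (p * (b - a))"
      using cosh_real_nonneg_le_iff[of "\<bar>p * (x - (a + b) / 2)\<bar>" "\<bar>p * (b - a)\<bar>"]
      by simp
    then have "\<bar>cosh (p * (x - (a + b) / 2)) * f ((a + b) / 2)\<bar> \<le> K"
      by (simp add: K_def abs_mult mult_right_mono)
    moreover have "f (a + b - x) \<le> M"
      using x by (intro upper) auto
    ultimately show ?thesis
      using hyperbolic_p_convex_on_midpoint[OF f \<open>p \<noteq> 0\<close> x] by linarith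
  qed
  have "0 \<le> K" by (simp add: K_def)
  then have "\<bar>f x\<bar> \<le> M + 2 * K" if "x \<in> {a..b}" for x
    using upper[OF that] lower[OF that] by linarith
  then show thesis by (rule that)
qed

text \<open>
  The continuous factor \<open>w\<close> is there for the kernels of the fractional integrals.
\<close>
lemma hyperbolic_p_convex_on_imp_absolutely_integrable:
  assumes f: "hyperbolic_p_convex_on p {a..b} f" and "p \<noteq> 0" and "a < b"
    and w: "continuous_on {a..b} w"
  shows "(\<lambda>x. w x * f x) absolutely_integrable_on {a..b}"
proof -
  obtain B where B: "\<And>x. x \<in> {a..b} \<Longrightarrow> \<bar>f x\<bar> \<le> B"
    using hyperbolic_p_convex_on_imp_bounded[OF f \<open>p \<noteq> 0\<close> \<open>a < b\<close>] by blast
  have "bounded (w ` {a..b})"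
    using w by (intro compact_imp_bounded compact_continuous_image) auto
  then obtain C where C: "\<And>x. x \<in> {a..b} \<Longrightarrow> \<bar>w x\<bar> \<le> C"
    by (metis bounded_iff imageI real_norm_def)
  show ?thesis
  proof (rule bounded_continuous_open_imp_absolutely_integrable)
    have "continuous_on {a<..<b} w"
      by (rule continuous_on_subset[OF w]) auto
    then show "continuous_on {a<..<b} (\<lambda>x. w x * f x)"
      using hyperbolic_p_convex_on_imp_continuous_on[OF f \<open>p \<noteq> 0\<close>] by (intro continuous_on_mult)
    show "\<bar>w x * f x\<bar> \<le> C * B" if "x \<in> {a<..<b}" for x
      using that B[of x] C[of x] by (auto simp: abs_mult intro!: mult_mono)
  qed
qed

section \<open>The Hermite--Hadamard inequality\<close>

theorem theorem2p2:
  fixes I :: "real set" and p \<alpha> a b :: real and u :: "real \<Rightarrow> real"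
  assumes "is_interval I"
    and "p \<noteq> 0"
    and "0 < \<alpha>" and "\<alpha> < 1"
    and "hyperbolic_p_convex_on p I u"
    and "a \<in> I" and "b \<in> I" and "a < b"
  shows "u ((a + b) / 2) * C2_one p \<alpha> a b
           \<le> frac_int_left \<alpha> a u b + frac_int_right \<alpha> b u a
       \<and> frac_int_left \<alpha> a u b + frac_int_right \<alpha> b u a
           \<le> (u a + u b) / 2 * (1 / cosh (p * (b - a) / 2)) * C2_one p \<alpha> a b"
proof -
  define k where "k = (1 - \<alpha>) / \<alpha>"
  define m where "m = (a + b) / 2"
  define w where "w = (\<lambda>x. (exp (- k * (b - x)) + exp (- k * (x - a))) / \<alpha>)"
  define c where "c = (\<lambda>x. cosh (p * (x - m)))"
  have "{a..b} \<subseteq> I"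
    using \<open>is_interval I\<close> \<open>a \<in> I\<close> \<open>b \<in> I\<close> by (meson atLeastAtMost_iff is_interval_1 subsetI)
  then have u: "hyperbolic_p_convex_on p {a..b} u"
    using \<open>hyperbolic_p_convex_on p I u\<close> by (rule hyperbolic_p_convex_on_subset[rotated])
  note u_int = hyperbolic_p_convex_on_imp_absolutely_integrable[OF u \<open>p \<noteq> 0\<close> \<open>a < b\<close>]
  have wu: "(\<lambda>x. w x * u x) integrable_on {a..b}"
    unfolding w_def using \<open>0 < \<alpha>\<close>
    by (intro set_lebesgue_integral_eq_integral(1) u_int continuous_intros) auto
  have frac: "frac_int_left \<alpha> a u b + frac_int_right \<alpha> b u a = integral {a..b} (\<lambda>x. w x * u x)"
  proof -
    have l: "(\<lambda>x. exp (- k * (b - x)) * u x) absolutely_integrable_on {a..b}"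
      by (intro u_int continuous_intros)
    have r: "(\<lambda>x. exp (- k * (x - a)) * u x) absolutely_integrable_on {a..b}"
      by (intro u_int continuous_intros)
    have "integral {a..b} (\<lambda>x. w x * u x) = integral {a..b}
        (\<lambda>x. 1 / \<alpha> * (exp (- k * (b - x)) * u x + exp (- k * (x - a)) * u x))"
      by (simp add: w_def algebra_simps add_divide_distrib)
    also have "\<dots> = 1 / \<alpha> * (integral {a..b} (\<lambda>x. exp (- k * (b - x)) * u x)
        + integral {a..b} (\<lambda>x. exp (- k * (x - a)) * u x))"
      using set_lebesgue_integral_eq_integral(1)[OF l] set_lebesgue_integral_eq_integral(1)[OF r]
      by (simp only: integral_mult_right integral_add)
    also have "\<dots> = frac_int_left \<alpha> a u b + frac_int_right \<alpha> b u a"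
      using set_lebesgue_integral_eq_integral(2)[OF l] set_lebesgue_integral_eq_integral(2)[OF r]
      by (simp add: frac_int_left_def frac_int_right_def distrib_left flip: k_def)
    finally show ?thesis ..
  qed
  have cw_cont: "continuous_on {a..b} (\<lambda>x. c x * w x)"
    unfolding c_def w_def using \<open>0 < \<alpha>\<close> by (intro continuous_intros) auto
  have C2: "C2_one p \<alpha> a b = integral {a..b} (\<lambda>x. c x * w x)"
    using set_lebesgue_integral_eq_integral(2)[OF absolutely_integrable_continuous_real[OF cw_cont]]
    by (simp add: C2_one_def c_def w_def k_def m_def)
  have cw: "(\<lambda>x. r * (c x * w x)) integrable_on {a..b}" for r
    by (intro integrable_continuous_real continuous_on_mult_left cw_cont)
  have C2_scaled: "r * C2_one p \<alpha> a b = integral {a..b} (\<lambda>x. r * (c x * w x))" for r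
    by (simp add: C2)
  have w_sym: "w (a + b - x) = w x" for x
    by (simp add: w_def algebra_simps)
  have w_pos: "0 \<le> w x" for x
    using \<open>0 < \<alpha>\<close> by (simp add: w_def)
  have c_sym: "c (a + b - x) = c x" for x
  proof -
    have "p * (a + b - x - m) = - (p * (x - m))"
      by (simp add: m_def field_simps)
    then show ?thesis by (simp only: c_def cosh_minus)
  qed
  have "u m * C2_one p \<alpha> a b \<le> integral {a..b} (\<lambda>x. w x * u x)"
    unfolding C2_scaled
  proof (rule integral_le_by_reflection[OF cw wu])
    fix x assume "x \<in> {a..b}"
    then have "w x * (2 * c x * u m) \<le> w x * (u x + u (a + b - x))"
      using hyperbolic_p_convex_on_midpoint[OF u \<open>p \<noteq> 0\<close>] w_pos
      by (intro mult_left_mono) (auto simp: c_def m_def)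
    then show "u m * (c x * w x) + u m * (c (a + b - x) * w (a + b - x))
        \<le> w x * u x + w (a + b - x) * u (a + b - x)"
      unfolding w_sym c_sym by (simp add: algebra_simps)
  qed
  moreover have "integral {a..b} (\<lambda>x. w x * u x)
      \<le> (u a + u b) / 2 * (1 / cosh (p * (b - a) / 2)) * C2_one p \<alpha> a b"
    unfolding C2_scaled
  proof (rule integral_le_by_reflection[OF wu cw])
    fix x assume "x \<in> {a..b}"
    then have "w x * (u x + u (a + b - x))
        \<le> w x * (c x / cosh (p * (b - a) / 2) * (u a + u b))"
      using hyperbolic_p_convex_on_endpoints[OF u \<open>p \<noteq> 0\<close> \<open>a < b\<close>] w_pos
      by (intro mult_left_mono) (auto simp: c_def m_def)
    also have "\<dots> = (u a + u b) / 2 * (1 / cosh (p * (b - a) / 2)) * (c x * w x)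
        + (u a + u b) / 2 * (1 / cosh (p * (b - a) / 2)) * (c x * w x)"
      by (simp add: field_simps)
    finally show "w x * u x + w (a + b - x) * u (a + b - x)
        \<le> (u a + u b) / 2 * (1 / cosh (p * (b - a) / 2)) * (c x * w x)
        + (u a + u b) / 2 * (1 / cosh (p * (b - a) / 2)) * (c (a + b - x) * w (a + b - x))"
      unfolding w_sym c_sym by (simp add: algebra_simps)
  qed
  ultimately show ?thesis
    unfolding frac m_def by simp
qed

end
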